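(* Let $p$ be an odd prime, let $n\geq 1$ be an integer, and set $q=p^n$. Let $m>1$ be an integer such that $2m\mid q-1$, and let $\Gamma=\Gamma_{q,m}$ be the generalized Paley graph. Then the following hold. (1) If $\omega(\Gamma)=\chi(\Gamma)$, then $\omega(\Gamma)=\chi(\Gamma)=p^{t}$ for some $t$ such that $t\mid n$. (2) If $n$ is a prime and $\omega(\Gamma)=\chi(\Gamma)$, then $m\mid p^{n-1}+p^{n-2}+\cdots+p+1$; further, in this case, $\omega(\Gamma)=\chi(\Gamma)=p$. (3) Suppose that $n$ is even. Then $\omega(\Gamma)=\chi(\Gamma)=p^{n/2}$ if and only if $m\mid p^{n/2}+1$. In particular (case $n=2$), $\omega(\Gamma_{p^2,m})=\chi(\Gamma_{p^2,m})$ if and only if $m\mid p+1$. (4) If $n$ is odd and $m$ is even, then $\omega(\Gamma)\neq\chi(\Gamma)$.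
   Context: For an odd prime-power $q$, $\mathbb{F}_q$ is the field with $q$ elements and $\mathbb{F}_q^*=\mathbb{F}_q\setminus\{0\}$ is its multiplicative group. For $m\mid q-1$ set $S_{q,m}=\{\alpha^m\mid\alpha\in\mathbb{F}_q^*\}$, the subgroup of $\mathbb{F}_q^*$ of order $(q-1)/m$. If $2m\mid q-1$ (so that $-1\in S_{q,m}$), the generalized Paley graph $\Gamma_{q,m}$ is the undirected simple graph with vertex set $\mathbb{F}_q$ and edge set $\{\{\alpha,\beta\}\mid\alpha-\beta\in S_{q,m}\}$. For a graph $\Gamma$, $\omega(\Gamma)$ is the clique number (largest size of a complete subgraph) and $\chi(\Gamma)$ is the chromatic number. *)

theory Defs
  imports
    Complex_Main
    "HOL-Library.Ramsey"
    "HOL-Library.Cardinality"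
    "HOL-Computational_Algebra.Primes"
begin

text \<open>An undirected graph is a pair of a vertex set and a set of (unordered) edges.
  Cliques are those of \<^theory>\<open>HOL-Library.Ramsey\<close>.\<close>

type_synonym 'a graph = "'a set \<times> 'a set set"

definition verts :: "'a graph \<Rightarrow> 'a set" where
  "verts G = fst G"

definition edges :: "'a graph \<Rightarrow> 'a set set" where
  "edges G = snd G"

text \<open>Meaningful for finite graphs only: \<^const>\<open>Max\<close> is unspecified on infinite sets.\<close>

definition clique_number :: "'a graph \<Rightarrow> nat" where
  "clique_number G = Max (card ` {K. K \<subseteq> verts G \<and> clique K (edges G)})"

definition proper_coloring :: "'a graph \<Rightarrow> nat \<Rightarrow> ('a \<Rightarrow> nat) \<Rightarrow> bool" where
  "proper_coloring G k c \<longleftrightarrow>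
     (\<forall>v\<in>verts G. c v < k) \<and>
     (\<forall>v\<in>verts G. \<forall>w\<in>verts G. {v, w} \<in> edges G \<longrightarrow> c v \<noteq> c w)"

text \<open>Meaningful for finite loopless graphs only: otherwise there may be no proper colouring.\<close>

definition chromatic_number :: "'a graph \<Rightarrow> nat" where
  "chromatic_number G = (LEAST k. \<exists>c. proper_coloring G k c)"

text \<open>The field $\mathbb{F}_q$ is a type of class \<^class>\<open>field\<close> with $q$ elements, so $q$ is
  determined by the type and does not appear as an argument below.\<close>

definition nonzero_powers :: "nat \<Rightarrow> 'a::field set" where
  "nonzero_powers m = {\<alpha> ^ m | \<alpha>. \<alpha> \<noteq> 0}"

text \<open>Since $0$ is not in \<^term>\<open>nonzero_powers m\<close>, the two elements of an edge are distinct.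
  When $-1$ is an $m$-th power, the order in which they are subtracted is irrelevant.\<close>

definition generalized_paley :: "nat \<Rightarrow> 'a::field graph" where
  "generalized_paley m = (UNIV, {{\<alpha>, \<beta>} | \<alpha> \<beta>. \<alpha> - \<beta> \<in> nonzero_powers m})"

end

theory Submission
  imports Defs "HOL-Number_Theory.Residues" "HOL-Computational_Algebra.Polynomial"
begin

text \<open>If the clique number \<open>\<omega>\<close> equals the chromatic number, every maximum clique meets every colour
  class of an optimal colouring exactly once. Counting over the translates of a clique gives
  \<open>\<omega> dvd q\<close>, so \<open>\<omega> = p ^ t\<close>; counting over its multiples by the \<open>m\<close>-th powers gives
  \<open>\<omega> - 1 dvd (q - 1) div m\<close>. The latter forces \<open>t dvd n\<close> and \<open>m dvd (q - 1) div (p ^ t - 1)\<close>,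
  from which every necessary condition follows.\<close>

section \<open>Cliques and colourings\<close>

lemma finite_cliques:
  assumes "finite (verts G)"
  shows "finite {K. K \<subseteq> verts G \<and> clique K (edges G)}"
  by (rule finite_subset[of _ "Pow (verts G)"]) (use assms in auto)

lemma card_le_clique_number:
  assumes "finite (verts G)" "K \<subseteq> verts G" "clique K (edges G)"
  shows "card K \<le> clique_number G"
  unfolding clique_number_def using finite_cliques[OF assms(1)] assms
  by (intro Max_ge) auto

text \<open>The empty clique makes the finite family nonempty, so its \<open>Max\<close> is
  attained.\<close>

lemma maximum_clique_exists:
  assumes "finite (verts G)"
  obtains K where "K \<subseteq> verts G" "clique K (edges G)" "card K = clique_number G"
proof -
  have "clique_number G \<in> card ` {K. K \<subseteq> verts G \<and> clique K (edges G)}"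
    unfolding clique_number_def
    by (rule Max_in) (use finite_cliques[OF assms] in \<open>auto intro: exI[of _ "{}"]\<close>)
  thus ?thesis using that by auto
qed

lemma chromatic_number_le:
  assumes "proper_coloring G k c"
  shows "chromatic_number G \<le> k"
  unfolding chromatic_number_def using assms by (blast intro: Least_le)

text \<open>In a loopless graph any injective numbering of the vertices is a proper colouring, so
  the \<open>LEAST\<close> in \<open>chromatic_number\<close> is attained.\<close>

lemma optimal_coloring_exists:
  assumes "finite (verts G)" "\<And>v. {v} \<notin> edges G"
  obtains c where "proper_coloring G (chromatic_number G) c"
proof -
  obtain c :: "'a \<Rightarrow> nat" and n where c: "c ` verts G = {..<n}" "inj_on c (verts G)"
    using finite_imp_inj_to_nat_seg[OF assms(1)] unfolding lessThan_def by blast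
  have "proper_coloring G n c"
    unfolding proper_coloring_def
  proof (intro conjI ballI impI)
    fix v w assume vw: "v \<in> verts G" "w \<in> verts G" "{v, w} \<in> edges G"
    hence "v \<noteq> w" using assms(2)[of v] by auto
    thus "c v \<noteq> c w" using c vw by (auto dest: inj_onD)
  qed (use c in auto)
  hence "\<exists>k c. proper_coloring G k c" by blast
  hence "\<exists>c. proper_coloring G (chromatic_number G) c"
    unfolding chromatic_number_def by (rule LeastI_ex)
  thus ?thesis using that by blast
qed

lemma coloring_inj_on_clique:
  assumes "proper_coloring G k c" "K \<subseteq> verts G" "clique K (edges G)"
  shows "inj_on c K"
  using assms unfolding proper_coloring_def clique_def inj_on_def by blast

lemma card_clique_le_colors:
  assumes "proper_coloring G k c" "K \<subseteq> verts G" "clique K (edges G)"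
  shows "card K \<le> k"
proof -
  have "c ` K \<subseteq> {..<k}" using assms unfolding proper_coloring_def by auto
  from card_inj_on_le[OF coloring_inj_on_clique[OF assms] this] show ?thesis by simp
qed

text \<open>Every colouring bounds every clique from above, so a clique and a colouring of equal
  size certify each other as optimal.\<close>

lemma clique_number_eq_chromatic_numberI:
  assumes "finite (verts G)" "\<And>v. {v} \<notin> edges G"
    and "proper_coloring G k c" "K \<subseteq> verts G" "clique K (edges G)" "card K = k"
  shows "clique_number G = k \<and> chromatic_number G = k"
proof -
  obtain c' where "proper_coloring G (chromatic_number G) c'"
    using optimal_coloring_exists[OF assms(1,2)] by blast
  hence 1: "k \<le> chromatic_number G" using card_clique_le_colors assms by metis
  obtain K' where "K' \<subseteq> verts G" "clique K' (edges G)" "card K' = clique_number G"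
    using maximum_clique_exists[OF assms(1)] by blast
  hence "clique_number G \<le> k" using card_clique_le_colors assms(3) by metis
  moreover have "k \<le> clique_number G" using card_le_clique_number assms by metis
  ultimately show ?thesis using 1 chromatic_number_le[OF assms(3)] by simp
qed

text \<open>The colouring is injective on \<open>K\<close> and has exactly \<open>card K\<close>
  colours available, so it maps \<open>K\<close> bijectively onto them.\<close>

lemma clique_meets_color_class_once:
  assumes "finite (verts G)" "proper_coloring G (card K) c"
    and "K \<subseteq> verts G" "clique K (edges G)" "i < card K"
  shows "card {x \<in> K. c x = i} = 1"
proof -
  have inj: "inj_on c K" using coloring_inj_on_clique assms by metis
  have "finite K" using assms finite_subset by blast
  hence "c ` K = {..<card K}"
    using assms inj unfolding proper_coloring_def
    by (intro card_subset_eq) (auto simp: card_image)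
  hence "i \<in> c ` K" using assms(5) by simp
  then obtain x where "x \<in> K" "c x = i" by auto
  hence "{x \<in> K. c x = i} = {x}" using inj by (auto dest: inj_onD)
  thus ?thesis by simp
qed

section \<open>Powers in a finite field\<close>

text \<open>Multiplication by \<open>x\<close> permutes the nonzero elements; comparing their
  product before and after leaves the power of \<open>x\<close> equal to 1.\<close>

lemma finite_field_power_card_minus_1:
  fixes x :: "'a::{field,finite}"
  assumes "x \<noteq> 0"
  shows "x ^ (CARD('a) - 1) = 1"
proof -
  have "(\<Prod>y\<in>UNIV-{0}. x * y) = (\<Prod>y\<in>UNIV-{0}. y)"
    by (rule prod.reindex_bij_witness[of _ "\<lambda>y. y / x" "\<lambda>y. x * y"]) (use assms in auto)
  thus ?thesis by (simp add: prod.distrib)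
qed

lemma card_power_eq_le:
  fixes b :: "'a::field"
  assumes "m > 0"
  shows "card {x. x ^ m = b} \<le> m"
proof -
  let ?f = "monom 1 m - [:b:]"
  \<comment> \<open>As \<open>m > 0\<close>, the constant \<open>b\<close> does not touch the
    leading coefficient, so the polynomial is nonzero.\<close>
  have "coeff ?f m = 1" using assms by (cases m) auto
  hence "?f \<noteq> 0" by (metis coeff_0 zero_neq_one)
  from card_poly_roots_bound[OF this] have "card {x. x ^ m = b} \<le> degree ?f"
    by (simp add: poly_monom)
  also have "degree ?f \<le> m" by (intro degree_diff_le) (auto simp: degree_monom_le)
  finally show ?thesis .
qed

text \<open>Two counts meet. The \<open>m\<close>-th powers are among the at most \<open>k\<close>
  roots of \<open>x ^ k = 1\<close>; conversely the \<open>m * k\<close> nonzero elements split into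
  fibres of size at most \<open>m\<close> over the \<open>m\<close>-th powers, so there are at least
  \<open>k\<close> of these.\<close>

lemma nonzero_powers_eq_roots_of_unity:
  fixes m k :: nat
  assumes q: "CARD('a::{field,finite}) = m * k + 1" and k: "k > 0" and m: "m > 0"
  shows "(nonzero_powers m :: 'a set) = {x. x ^ k = 1}"
    and "card (nonzero_powers m :: 'a set) = k"
proof -
  let ?S = "nonzero_powers m :: 'a set" and ?R = "{x :: 'a. x ^ k = 1}"
  have sub: "?S \<subseteq> ?R"
  proof
    fix x assume "x \<in> ?S"
    then obtain a :: 'a where "x = a ^ m" "a \<noteq> 0" unfolding nonzero_powers_def by auto
    thus "x \<in> ?R" using finite_field_power_card_minus_1[of a] q
      by (simp flip: power_mult)
  qed
  have R: "card ?R \<le> k" using card_power_eq_le[OF k] .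
  have "(UNIV - {0}) = (\<Union>y\<in>?S. {x. x ^ m = y})"
    using m unfolding nonzero_powers_def by (auto simp: power_0_left)
  hence "m * k = card (\<Union>y\<in>?S. {x. x ^ m = y})"
    using q by (metis add_diff_cancel_right' card_Diff_singleton finite UNIV_I)
  also have "\<dots> \<le> (\<Sum>y\<in>?S. card {x. x ^ m = y})" by (rule card_UN_le) simp
  also have "\<dots> \<le> (\<Sum>y\<in>?S. m)" by (intro sum_mono card_power_eq_le m)
  finally have "k \<le> card ?S" using m by simp
  moreover have "card ?S \<le> card ?R" using sub by (intro card_mono) auto
  ultimately have eq: "card ?S = k" "card ?S = card ?R" using R by auto
  show "card ?S = k" by fact
  show "?S = ?R" using sub eq by (intro card_subset_eq) auto
qed

lemma one_in_nonzero_powers: "1 \<in> nonzero_powers m"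
  unfolding nonzero_powers_def by (auto intro: exI[of _ 1])

lemma zero_notin_nonzero_powers [simp]: "0 \<notin> nonzero_powers m"
  unfolding nonzero_powers_def by auto

lemma mult_in_nonzero_powers:
  assumes "x \<in> nonzero_powers m" "y \<in> nonzero_powers m"
  shows "x * y \<in> nonzero_powers m"
  using assms unfolding nonzero_powers_def
  by clarsimp (metis mult_eq_0_iff power_mult_distrib)

lemma inverse_in_nonzero_powers:
  assumes "x \<in> nonzero_powers m"
  shows "inverse x \<in> nonzero_powers m"
  using assms unfolding nonzero_powers_def
  by clarsimp (metis inverse_nonzero_iff_nonzero power_inverse)

lemma divide_in_nonzero_powers:
  assumes "x \<in> nonzero_powers m" "y \<in> nonzero_powers m"
  shows "x / y \<in> nonzero_powers m"
  using assms by (simp add: divide_inverse mult_in_nonzero_powers inverse_in_nonzero_powers)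

lemma nonzero_powers_mono:
  assumes "m dvd d"
  shows "nonzero_powers d \<subseteq> nonzero_powers m"
proof -
  obtain e where d: "d = e * m" using assms by (metis dvd_def mult.commute)
  show ?thesis unfolding nonzero_powers_def d
    by clarsimp (metis power_mult power_not_zero)
qed

lemma CHAR_eq_prime:
  assumes "prime p" "CARD('a::{field,finite}) = p ^ n"
  shows "CHAR('a) = p"
proof -
  have "CHAR('a) > 0" by (rule finite_imp_CHAR_pos) simp
  hence 1: "prime CHAR('a)" by (rule prime_CHAR_semidom)
  have "CHAR('a) dvd p ^ n" using CHAR_dvd_CARD[where 'a = 'a] assms by simp
  hence "CHAR('a) dvd p" using 1 prime_dvd_power by blast
  thus ?thesis using 1 assms primes_dvd_imp_eq by blast
qed

section \<open>Cliques in generalized Paley graphs\<close>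

lemma verts_paley [simp]: "verts (generalized_paley m) = UNIV"
  by (simp add: verts_def generalized_paley_def)

lemma loop_notin_paley: "{v} \<notin> edges (generalized_paley m)"
  by (auto simp: edges_def generalized_paley_def doubleton_eq_iff singleton_insert_inj_eq)

locale symmetric_paley =
  fixes m :: nat and ty :: "'a::{field,finite} itself"
  assumes minus_one: "- 1 \<in> (nonzero_powers m :: 'a set)"
begin

abbreviation S :: "'a set" where "S \<equiv> nonzero_powers m"
abbreviation \<Gamma> :: "'a graph" where "\<Gamma> \<equiv> generalized_paley m"

lemma minus_commute_in_powers: "x - y \<in> S \<longleftrightarrow> y - x \<in> S"
  using mult_in_nonzero_powers[OF minus_one, of "x - y"]
    mult_in_nonzero_powers[OF minus_one, of "y - x"] by auto

lemma edge_paley_iff: "{x, y} \<in> edges \<Gamma> \<longleftrightarrow> x - y \<in> S"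
  using minus_commute_in_powers
  by (auto simp: edges_def generalized_paley_def doubleton_eq_iff)

lemma clique_paley_iff: "clique K (edges \<Gamma>) \<longleftrightarrow> (\<forall>x\<in>K. \<forall>y\<in>K. x \<noteq> y \<longrightarrow> x - y \<in> S)"
  by (simp add: clique_def edge_paley_iff)

lemma clique_affine_image:
  assumes "clique K (edges \<Gamma>)" "s \<in> S"
  shows "clique ((\<lambda>y. s * y + v) ` K) (edges \<Gamma>)"
  using assms mult_in_nonzero_powers[OF assms(2)]
  unfolding clique_paley_iff by (auto simp flip: right_diff_distrib)

text \<open>The image of \<open>K\<close> is again a clique of the same size. The count is pulled
  back to \<open>K\<close> so that it can serve as a summand in the double counts below.\<close>

lemma affine_image_meets_color_class_once:
  assumes c: "proper_coloring \<Gamma> (card K) c" and K: "clique K (edges \<Gamma>)"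
    and i: "i < card K" and s: "s \<in> S"
  shows "card {y \<in> K. c (s * y + v) = i} = 1"
proof -
  have inj: "inj (\<lambda>y. s * y + v)"
    using s by (intro injI) auto
  have ck: "card ((\<lambda>y. s * y + v) ` K) = card K"
    using inj by (intro card_image) (auto intro: inj_on_subset)
  have "card {x \<in> (\<lambda>y. s * y + v) ` K. c x = i} = 1"
    by (rule clique_meets_color_class_once[of \<Gamma>])
      (use c i ck clique_affine_image[OF K s] in auto)
  also have "{x \<in> (\<lambda>y. s * y + v) ` K. c x = i} = (\<lambda>y. s * y + v) ` {y \<in> K. c (s * y + v) = i}"
    by auto
  also have "card \<dots> = card {y \<in> K. c (s * y + v) = i}"
    using inj by (intro card_image) (auto intro: inj_on_subset)
  finally show ?thesis .
qed

lemma card_clique_dvd_card_field: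
  assumes "proper_coloring \<Gamma> (card K) c" "clique K (edges \<Gamma>)" "card K > 0"
  shows "card K dvd CARD('a)"
proof -
  \<comment> \<open>Count the pairs \<open>(y, v)\<close> with \<open>y + v\<close> of colour 0:
    each \<open>v\<close> admits one \<open>y\<close>, and each \<open>y\<close> admits as many
    \<open>v\<close> as the class has points.\<close>
  have "(\<Sum>v\<in>(UNIV :: 'a set). card {y \<in> K. c (y + v) = 0}) = card {x. c x = 0} * card K"
  proof (rule sum_multicount)
    show "\<forall>y\<in>K. card {v \<in> UNIV. c (y + v) = 0} = card {x. c x = 0}"
      by (auto intro!: bij_betw_same_card[of "\<lambda>v. _ + v"] bij_betw_byWitness[of _ "\<lambda>x. x - _"])
  qed simp_all
  moreover have "card {y \<in> K. c (y + v) = 0} = 1" for v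
    using affine_image_meets_color_class_once[OF assms one_in_nonzero_powers] by simp
  ultimately show ?thesis by simp
qed

text \<open>Fix a colour class avoiding \<open>0\<close> and a clique \<open>K\<close> through \<open>0\<close>. Each multiple of \<open>K\<close> by an
  element of \<open>S\<close> has exactly one point in the class, and each neighbour of \<open>0\<close> in the class lies on
  exactly \<open>card K - 1\<close> of them, counted by the nonzero \<open>y \<in> K\<close> that is scaled onto it.\<close>

lemma card_clique_minus_1_dvd:
  assumes c: "proper_coloring \<Gamma> (card K) c" and K: "clique K (edges \<Gamma>)" and ge2: "card K \<ge> 2"
  shows "card K - 1 dvd card S"
proof -
  obtain a where a: "a \<in> K" using ge2 by fastforce
  define L where "L = (\<lambda>x. x - a) ` K"
  have L: "clique L (edges \<Gamma>)"
    using clique_affine_image[OF K one_in_nonzero_powers, of "- a"] by (simp add: L_def)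
  have cL: "card L = card K" unfolding L_def by (intro card_image) (auto intro: inj_onI)
  have "0 \<in> L" using a by (auto simp: L_def)
  have LS: "L - {0} \<subseteq> S" using L \<open>0 \<in> L\<close> unfolding clique_paley_iff by force
  obtain i where i: "i < card K" "i \<noteq> c 0"
  proof (cases "c 0 = 0")
    case True thus ?thesis using that[of 1] ge2 by simp
  next
    case False thus ?thesis using that[of 0] ge2 by simp
  qed
  have "(\<Sum>s\<in>S. card {y \<in> L - {0}. c (s * y) = i}) = card {x \<in> S. c x = i} * card (L - {0})"
  proof (rule sum_multicount)
    show "\<forall>y\<in>L - {0}. card {s \<in> S. c (s * y) = i} = card {x \<in> S. c x = i}"
    proof
      fix y assume y: "y \<in> L - {0}"
      hence "y \<in> S" using LS by auto
      show "card {s \<in> S. c (s * y) = i} = card {x \<in> S. c x = i}"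
        by (rule bij_betw_same_card[of "\<lambda>s. s * y"],
            rule bij_betw_byWitness[of _ "\<lambda>x. x / y"])
          (use y \<open>y \<in> S\<close> in \<open>auto intro: mult_in_nonzero_powers divide_in_nonzero_powers\<close>)
    qed
  qed simp_all
  moreover have "card {y \<in> L - {0}. c (s * y) = i} = 1" if "s \<in> S" for s
  proof -
    \<comment> \<open>Dropping 0 loses no point, since \<open>i\<close> differs from
      \<open>c 0\<close>.\<close>
    have "{y \<in> L - {0}. c (s * y) = i} = {y \<in> L. c (s * y + 0) = i}" using i by auto
    thus ?thesis
      using affine_image_meets_color_class_once[of L c i s 0] c L i that cL by simp
  qed
  ultimately have "card S = card {x \<in> S. c x = i} * card (L - {0})" by simp
  moreover have "card (L - {0}) = card K - 1" using \<open>0 \<in> L\<close> cL by simp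
  ultimately show ?thesis by simp
qed

lemma clique_number_eq_chromatic_number_imp:
  assumes "clique_number \<Gamma> = chromatic_number \<Gamma>"
  shows "clique_number \<Gamma> \<ge> 2" "clique_number \<Gamma> dvd CARD('a)" "clique_number \<Gamma> - 1 dvd card S"
proof -
  obtain K where K: "clique K (edges \<Gamma>)" "card K = clique_number \<Gamma>"
    using maximum_clique_exists[of \<Gamma>] by auto
  obtain c where c: "proper_coloring \<Gamma> (card K) c"
    using optimal_coloring_exists[of \<Gamma>] loop_notin_paley assms K by auto
  \<comment> \<open>The bound 2 from this edge later excludes the exponent
    \<open>t = 0\<close>.\<close>
  have "clique {0, 1} (edges \<Gamma>)"
    using minus_one one_in_nonzero_powers by (auto simp: clique_paley_iff)
  from card_le_clique_number[OF _ _ this] show ge2: "clique_number \<Gamma> \<ge> 2" by simp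
  show "clique_number \<Gamma> dvd CARD('a)" "clique_number \<Gamma> - 1 dvd card S"
    using card_clique_dvd_card_field[OF c] card_clique_minus_1_dvd[OF c] K ge2 by simp_all
qed

text \<open>The subfield of order \<open>r\<close> is a clique. For \<open>g \<notin> S\<close>, the cosets of its multiple by \<open>g\<close> are
  independent sets; they are the fibres of the additive map \<open>x \<mapsto> (x / g) ^ r - x / g\<close>, all of whose
  values satisfy \<open>y ^ r = - y\<close>.\<close>

lemma subfield_clique_and_coloring:
  assumes p: "prime p" "CARD('a) = p ^ n" and r: "r = p ^ k" "r > 1" "CARD('a) = r * r"
    and m: "m > 1" "m dvd r + 1"
  shows "clique_number \<Gamma> = r \<and> chromatic_number \<Gamma> = r"
proof -
  have q: "CARD('a) = (r + 1) * (r - 1) + 1"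
    using r(2) unfolding r(3) by (cases r) auto
  define F where "F = {x :: 'a. x ^ r = x}"
  have pr: "x ^ r = x * x ^ (r - 1)" for x :: 'a using r(2) by (cases r) auto
  \<comment> \<open>Nonzero solutions of \<open>x ^ r = x\<close> are the roots of
    \<open>x ^ (r - 1) = 1\<close>, hence the \<open>(r + 1)\<close>-th powers by the factorisation
    \<open>q\<close>. As \<open>m dvd r + 1\<close>, they lie in \<open>S\<close>.\<close>
  have F: "F = insert 0 (nonzero_powers (r + 1))"
    using nonzero_powers_eq_roots_of_unity(1)[OF q] r(2) by (auto simp: F_def pr)
  have cF: "card F = r"
    unfolding F using nonzero_powers_eq_roots_of_unity(2)[OF q] r(2)
    by (subst card_insert_disjoint) auto
  have FS: "x \<in> S" if "x \<in> F" "x \<noteq> 0" for x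
    using that nonzero_powers_mono[OF m(2)] unfolding F by auto
  have char: "prime CHAR('a)" "r = CHAR('a) ^ k" using CHAR_eq_prime[OF p] p(1) r(1) by simp_all
  have add: "(x + y) ^ r = x ^ r + y ^ r" for x y :: 'a
    using freshmans_dream'[OF char] .
  have diff: "(x - y) ^ r = x ^ r - y ^ r" for x y :: 'a
    using add[of "x - y" y] by (simp add: algebra_simps)
  have rr: "(x ^ r) ^ r = x" for x :: 'a
  proof (cases "x = 0")
    case False
    have "Suc (CARD('a) - 1) = r * r" using r(2) by (simp add: r(3))
    hence "(x ^ r) ^ r = x ^ Suc (CARD('a) - 1)" by (simp only: power_mult)
    also have "\<dots> = x" by (simp only: power_Suc finite_field_power_card_minus_1[OF False] mult_1_right)
    finally show ?thesis .
  qed (use r(2) in simp)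
  have "x - y \<in> F" if "x \<in> F" "y \<in> F" for x y using that by (simp add: F_def diff)
  hence clique: "clique F (edges \<Gamma>)"
    unfolding clique_paley_iff by (simp add: FS)
  \<comment> \<open>\<open>S\<close> contains only one \<open>m\<close>-th of the nonzero elements,
    and \<open>m > 1\<close>.\<close>
  obtain g where g: "g \<noteq> 0" "g \<notin> S"
  proof -
    obtain e where e: "r + 1 = m * e" using m by auto
    have q': "CARD('a) = m * (e * (r - 1)) + 1" using q unfolding e by (simp only: mult.assoc)
    have "e > 0" using e by (cases e) auto
    hence "card S = e * (r - 1)" using nonzero_powers_eq_roots_of_unity(2)[OF q'] r(2) m(1) by simp
    moreover have "e * (r - 1) < m * (e * (r - 1))" using m(1) r(2) \<open>e > 0\<close> by simp
    ultimately have "card (insert 0 S) < card (UNIV :: 'a set)"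
      using q' by (simp add: card_insert_if)
    hence "insert 0 S \<noteq> UNIV" by (metis less_irrefl)
    thus ?thesis using that by auto
  qed
  define \<phi> where "\<phi> x = (x / g) ^ r - x / g" for x
  \<comment> \<open>The \<open>r\<close>-th power map is an additive involution, so it negates each
    value of \<open>\<phi>\<close>. Zero and at most \<open>r - 1\<close> roots leave at most
    \<open>r\<close> colours.\<close>
  have "range \<phi> \<subseteq> insert 0 {y. y ^ (r - 1) = - 1}"
  proof
    fix y assume "y \<in> range \<phi>"
    then obtain x where "y = (x / g) ^ r - x / g" by (auto simp: \<phi>_def)
    hence "y ^ r = - y" by (simp only: diff rr) simp
    hence "y * (y ^ (r - 1) + 1) = 0" by (simp add: pr algebra_simps)
    thus "y \<in> insert 0 {y. y ^ (r - 1) = - 1}" by (auto simp: add_eq_0_iff2)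
  qed
  hence "card (range \<phi>) \<le> card (insert 0 {y :: 'a. y ^ (r - 1) = - 1})"
    by (intro card_mono) auto
  also have "\<dots> \<le> Suc (card {y :: 'a. y ^ (r - 1) = - 1})" by (rule card_insert_le_m1) auto
  also have "\<dots> \<le> r" using card_power_eq_le[of "r - 1" "- 1 :: 'a"] r(2) by simp
  finally have "card (range \<phi>) \<le> r" .
  then obtain f :: "'a \<Rightarrow> nat" where f: "f ` range \<phi> \<subseteq> {..<r}" "inj_on f (range \<phi>)"
    using card_le_inj[of "range \<phi>" "{..<r}"] by auto
  have "proper_coloring \<Gamma> r (f \<circ> \<phi>)"
    unfolding proper_coloring_def edge_paley_iff
  proof (intro conjI ballI impI notI)
    fix v w assume vw: "v - w \<in> S" and "(f \<circ> \<phi>) v = (f \<circ> \<phi>) w"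
    hence "\<phi> v = \<phi> w" using f by (auto dest: inj_onD)
    hence "(v / g) ^ r - (w / g) ^ r = v / g - w / g" by (simp add: \<phi>_def algebra_simps)
    hence "(v - w) / g \<in> F" unfolding F_def by (simp only: diff diff_divide_distrib mem_Collect_eq)
    moreover have "(v - w) / g \<noteq> 0" using vw g by auto
    \<comment> \<open>Both \<open>v - w\<close> and the nonzero element \<open>(v - w) / g\<close>
      of \<open>F\<close> lie in \<open>S\<close>; their quotient is \<open>g\<close>, which does
      not.\<close>
    ultimately have "(v - w) / ((v - w) / g) \<in> S" using vw FS divide_in_nonzero_powers by blast
    thus False using g vw by (auto split: if_splits)
  qed (use f in auto)
  thus ?thesis
    using clique_number_eq_chromatic_numberI[of \<Gamma> r "f \<circ> \<phi>" F] clique cF loop_notin_paley by auto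
qed

end

section \<open>Divisibility of numbers of the form \<open>p ^ n - 1\<close>\<close>

text \<open>Euclidean descent: \<open>p ^ n - 1\<close> and \<open>p ^ (n - t) - 1\<close> differ by
  a multiple of \<open>p ^ t - 1\<close>. Once \<open>n < t\<close>, the dividend is smaller than
  the divisor, so it is 0 and \<open>n = 0\<close>.\<close>

lemma power_minus_1_dvd_imp_dvd:
  fixes p :: nat
  assumes "p \<ge> 2" "t > 0" "p ^ t - 1 dvd p ^ n - 1"
  shows "t dvd n"
  using assms(3)
proof (induction n rule: less_induct)
  case (less n)
  show ?case
  proof (cases "n < t")
    case True
    hence "p ^ n < p ^ t" using assms(1) by (intro power_strict_increasing) auto
    moreover have "p ^ n \<ge> 1" using assms(1) by simp
    ultimately have "p ^ n - 1 = 0"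
      using less.prems nat_dvd_not_less[of "p ^ n - 1" "p ^ t - 1"] by linarith
    hence "p ^ n = 1" using \<open>p ^ n \<ge> 1\<close> by simp
    thus ?thesis using assms(1) by (simp add: power_eq_1_iff)
  next
    case False
    have ge: "p ^ t \<ge> 1" "p ^ (n - t) \<ge> 1" using assms(1) by simp_all
    have "p ^ n = p ^ (n - t) * p ^ t" using False by (simp flip: power_add)
    also have "\<dots> - 1 = p ^ (n - t) * (p ^ t - 1) + (p ^ (n - t) - 1)"
      using ge by (simp add: diff_mult_distrib2)
    finally have "p ^ t - 1 dvd p ^ (n - t) * (p ^ t - 1) + (p ^ (n - t) - 1)"
      using less.prems by simp
    hence "p ^ t - 1 dvd p ^ (n - t) - 1"
      by (subst (asm) dvd_add_right_iff) simp_all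
    hence "t dvd n - t" using less.IH[of "n - t"] False assms(2) by simp
    thus ?thesis using False dvd_add[of t "n - t" t] by simp
  qed
qed

lemma power_minus_1_eq_sum:
  fixes p :: nat
  assumes "p > 0"
  shows "p ^ n - 1 = (p - 1) * (\<Sum>i<n. p ^ i)"
proof -
  \<comment> \<open>The geometric sum is evaluated in the ring of integers; \<open>p > 0\<close>
    keeps the truncated differences exact.\<close>
  have "int (p ^ n - 1) = int p ^ n - 1" using assms by (simp add: of_nat_diff)
  also have "\<dots> = (int p - 1) * (\<Sum>i<n. int p ^ i)" by (rule power_diff_1_eq)
  also have "\<dots> = int ((p - 1) * (\<Sum>i<n. p ^ i))" using assms by (simp add: of_nat_diff)
  finally have "int (p ^ n - 1) = int ((p - 1) * (\<Sum>i<n. p ^ i))" .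
  thus ?thesis by (simp only: of_nat_eq_iff)
qed

theorem theorem4p7:
  fixes p n m :: nat and \<Gamma> :: "'a::{field,finite} graph"
  assumes "prime p" and "odd p" and "n \<ge> 1"
    and "CARD('a) = p ^ n"
    and "m > 1" and "2 * m dvd p ^ n - 1"
    and "\<Gamma> = generalized_paley m"
  shows
    "(clique_number \<Gamma> = chromatic_number \<Gamma> \<longrightarrow>
        (\<exists>t. t dvd n \<and> clique_number \<Gamma> = p ^ t \<and> chromatic_number \<Gamma> = p ^ t)) \<and>
     (prime n \<and> clique_number \<Gamma> = chromatic_number \<Gamma> \<longrightarrow>
        m dvd (\<Sum>i<n. p ^ i) \<and> clique_number \<Gamma> = p \<and> chromatic_number \<Gamma> = p) \<and>
     (even n \<longrightarrow>
        (clique_number \<Gamma> = p ^ (n div 2) \<and> chromatic_number \<Gamma> = p ^ (n div 2)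
           \<longleftrightarrow> m dvd p ^ (n div 2) + 1)) \<and>
     (n = 2 \<longrightarrow>
        (clique_number \<Gamma> = chromatic_number \<Gamma> \<longleftrightarrow> m dvd p + 1)) \<and>
     (odd n \<and> even m \<longrightarrow> clique_number \<Gamma> \<noteq> chromatic_number \<Gamma>)"
proof -
  have p2: "p \<ge> 2" using assms prime_ge_2_nat by blast
  have pn: "p ^ n > 1" using p2 assms by (intro one_less_power) auto
  obtain e where e: "p ^ n - 1 = 2 * m * e" using assms by auto
  have q: "CARD('a) = m * (2 * e) + 1" using e assms pn by simp
  have e0: "2 * e > 0" using e pn by (cases e) auto
  have m0: "m > 0" using assms by simp
  note powers = nonzero_powers_eq_roots_of_unity[OF q e0 m0]
  \<comment> \<open>The exponent \<open>2 * e\<close> is even, so -1 is a root of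
    \<open>x ^ (2 * e) = 1\<close> and thus an \<open>m\<close>-th power.\<close>
  interpret symmetric_paley m "TYPE('a)"
    by standard (simp add: powers)
  \<comment> \<open>The last conjunct is \<open>\<omega> - 1 dvd (q - 1) div m\<close> with
    \<open>m\<close> multiplied across; all the necessary conditions are read off from it.\<close>
  have main: "\<exists>t. t > 0 \<and> t dvd n \<and> clique_number \<Gamma> = p ^ t \<and> m * (p ^ t - 1) dvd p ^ n - 1"
    if "clique_number \<Gamma> = chromatic_number \<Gamma>"
  proof -
    note \<omega> = clique_number_eq_chromatic_number_imp[folded assms(7), OF that]
    obtain t where t: "clique_number \<Gamma> = p ^ t"
      using \<omega>(2) assms divides_primepow_nat by metis
    have "t > 0" using \<omega>(1) t by (cases t) auto
    have dvd: "m * (p ^ t - 1) dvd p ^ n - 1"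
      using \<omega>(3) t powers(2) e by (simp add: mult.assoc mult.left_commute)
    hence "t dvd n"
      using power_minus_1_dvd_imp_dvd[OF p2 \<open>t > 0\<close>] by (meson dvd_mult_right)
    thus ?thesis using \<open>t > 0\<close> t dvd by blast
  qed
  have prime: "m dvd (\<Sum>i<n. p ^ i) \<and> clique_number \<Gamma> = p"
    if n: "prime n" and eq: "clique_number \<Gamma> = chromatic_number \<Gamma>"
  proof -
    obtain t where t: "t dvd n" "clique_number \<Gamma> = p ^ t" "m * (p ^ t - 1) dvd p ^ n - 1"
      using main[OF eq] by blast
    \<comment> \<open>For \<open>t = n\<close> the divisibility would cancel to
      \<open>m dvd 1\<close>.\<close>
    have "t \<noteq> n"
    proof
      assume "t = n"
      hence "m dvd 1" using t(3) pn by (simp add: dvd_mult_cancel2)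
      thus False using assms by simp
    qed
    hence "t = 1" using n t by (auto simp: prime_nat_iff)
    moreover from this have "m dvd (\<Sum>i<n. p ^ i)"
      using t(3) power_minus_1_eq_sum[of p n] p2 by (simp add: mult.commute)
    ultimately show ?thesis using t by simp
  qed
  have half: "clique_number \<Gamma> = p ^ (n div 2) \<and> chromatic_number \<Gamma> = p ^ (n div 2)
           \<longleftrightarrow> m dvd p ^ (n div 2) + 1" if "even n"
  proof -
    define r where "r = p ^ (n div 2)"
    have "n div 2 > 0" using that assms by (auto elim: evenE)
    hence r1: "r > 1" using p2 unfolding r_def by (intro one_less_power) auto
    have rr: "p ^ n = r * r" using that by (simp add: r_def flip: power_add mult_2)
    hence fac: "p ^ n - 1 = (r + 1) * (r - 1)" using r1 by (cases r) auto
    have "m dvd r + 1" if "clique_number \<Gamma> = r" "chromatic_number \<Gamma> = r"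
    proof -
      \<comment> \<open>This is \<open>main\<close> with \<open>p ^ t = r\<close>.\<close>
      have "m * (r - 1) dvd (r + 1) * (r - 1)" using main that fac by fastforce
      thus ?thesis using r1 dvd_times_right_cancel_iff[of "r - 1" m "r + 1"] by simp
    qed
    moreover have "clique_number \<Gamma> = r \<and> chromatic_number \<Gamma> = r" if "m dvd r + 1"
      using subfield_clique_and_coloring[OF assms(1,4) r_def r1 _ assms(5) that] assms rr by simp
    ultimately show ?thesis unfolding r_def by blast
  qed
  have "clique_number \<Gamma> \<noteq> chromatic_number \<Gamma>" if "odd n" "even m"
  proof
    assume "clique_number \<Gamma> = chromatic_number \<Gamma>"
    then obtain t where t: "t > 0" "t dvd n" "m * (p ^ t - 1) dvd p ^ n - 1" using main by blast
    obtain d where d: "n = t * d" using t by auto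
    have pt: "p ^ t > 1" using p2 t by (intro one_less_power) auto
    have "p ^ n - 1 = (p ^ t - 1) * (\<Sum>i<d. (p ^ t) ^ i)"
      using power_minus_1_eq_sum[of "p ^ t" d] p2 by (simp add: d power_mult)
    hence "m dvd (\<Sum>i<d. (p ^ t) ^ i)" using t(3) pt by (simp add: mult.commute)
    \<comment> \<open>But the sum has \<open>d\<close> odd terms, and \<open>d\<close> is odd as a
      divisor of the odd \<open>n\<close>.\<close>
    hence "even (\<Sum>i<d. (p ^ t) ^ i)" using that dvd_trans by blast
    moreover have "odd d" using that d by simp
    ultimately show False using assms(2) by (simp add: even_sum_iff)
  qed
  moreover have "clique_number \<Gamma> = chromatic_number \<Gamma> \<longleftrightarrow> m dvd p + 1" if "n = 2"
    using half prime that by auto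
  ultimately show ?thesis using main prime half by metis
qed

end
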